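(* Let $R=\prod_{i=1}^{m}R_i$, where $R_1,R_2,\ldots,R_m$ are finite commutative rings. Then, for every integer $k\ge 2$, $$\zeta_k(R)=\prod_{i=1}^{m}\zeta_k(R_i).$$
   Context: For a finite commutative ring $R$, let $\mathcal I(R)$ denote the set of all ideals of $R$, and let $(0)$ denote the zero ideal. For an integer $k\ge 2$, the ideal zero-product probability is $$\zeta_k(R)=\frac{|\{(I_1,\ldots,I_k)\in\mathcal I(R)^k : I_1I_2\cdots I_k=(0)\}|}{|\mathcal I(R)|^k},$$ where $I_1\cdots I_k$ is the usual product of ideals. *)

theory Defs
  imports "HOL-Algebra.Algebra"
begin

abbreviation ideals :: "('a, 'b) ring_scheme \<Rightarrow> 'a set set"
  where "ideals R \<equiv> {I. ideal I R}"

(* A k-tuple of ideals is an extensional function on {1..k}.  The k-fold product of ideals is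
   the finite product in the commutative monoid ideals_set R, whose multiplication is the
   ideal product ideal_prod R and whose unit is the whole ring; hence R should be a cring. *)
definition zeta :: "nat \<Rightarrow> ('a, 'b) ring_scheme \<Rightarrow> real"
  where "zeta k R =
    real (card {I \<in> {1..k} \<rightarrow>\<^sub>E ideals R.
                (\<Otimes>\<^bsub>ideals_set R\<^esub> i\<in>{1..k}. I i) = {\<zero>\<^bsub>R\<^esub>}})
    / real (card (ideals R)) ^ k"

end

(* A surjective ring homomorphism maps ideals to ideals and commutes with products of ideals. If
   T is the product of R and S with projections f and g, then K |-> (f(K), g(K)) is therefore a
   multiplicative bijection from the ideals of T to pairs of ideals of R and S. It sends (0) to
   ((0), (0)), so the numerator and the denominator of the zero-product probability both factor. *)

theory Submission
  imports Defs
begin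

section \<open>Images of ideals and of their products under surjective homomorphisms\<close>

text \<open>Between monoids, membership in \<open>hom\<close> does not force the unit to be
  preserved, so this is a separate assumption; it settles the empty index set and also infinite
  ones, where the product is the unit by convention.\<close>

lemma hom_finprod:
  assumes "comm_monoid G" "comm_monoid H" "h \<in> hom G H" "h \<one>\<^bsub>G\<^esub> = \<one>\<^bsub>H\<^esub>"
    and "u \<in> A \<rightarrow> carrier G"
  shows "h (\<Otimes>\<^bsub>G\<^esub>i\<in>A. u i) = (\<Otimes>\<^bsub>H\<^esub>i\<in>A. h (u i))"
proof -
  interpret G: comm_monoid G by fact
  interpret H: comm_monoid H by fact
  show ?thesis
    using assms(5)
  proof (induction A rule: infinite_finite_induct)
    case (insert a A)
    then have "u \<in> A \<rightarrow> carrier G" "u a \<in> carrier G"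
      by auto
    moreover from this have "(\<lambda>i. h (u i)) \<in> A \<rightarrow> carrier H" "h (u a) \<in> carrier H"
      using assms(3) by (auto simp: hom_def)
    ultimately show ?case
      using insert hom_mult[OF assms(3)] by (simp add: G.finprod_closed)
  qed (use assms(4) in auto)
qed

lemma (in ring_hom_ring) surj_image_ideal:
  assumes surj: "h ` carrier R = carrier S" and I: "ideal I R"
  shows "ideal (h ` I) S"
proof (rule idealI)
  show "ring S" by (rule S.ring_axioms)
  interpret I: ideal I R by (rule I)
  show "subgroup (h ` I) (add_monoid S)"
    using abelian_group_hom.a_group_hom[OF abelian_group_hom_axioms] I.a_subgroup
    by (rule group_hom.subgroup_img_is_subgroup)
next
  fix a x assume "a \<in> h ` I" "x \<in> carrier S"
  \<comment> \<open>Absorption is where surjectivity enters: the arbitrary multiplier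
    \<open>x\<close> from \<open>S\<close> is lifted to \<open>y\<close> in
    \<open>R\<close>.\<close>
  then obtain b y where b: "b \<in> I" "a = h b" and y: "y \<in> carrier R" "x = h y"
    using surj by blast
  then have "x \<otimes>\<^bsub>S\<^esub> a = h (y \<otimes> b)" "a \<otimes>\<^bsub>S\<^esub> x = h (b \<otimes> y)"
    using ideal.Icarr[OF I] by auto
  then show "x \<otimes>\<^bsub>S\<^esub> a \<in> h ` I" "a \<otimes>\<^bsub>S\<^esub> x \<in> h ` I"
    using b y ideal.I_l_closed[OF I] ideal.I_r_closed[OF I] by auto
qed

text \<open>\<open>ideal_prod\<close> is generated inductively from products of elements by closing
  under sums, and \<open>h\<close> respects both operations; each inclusion is an induction over
  this generation.\<close>

lemma (in ring_hom_ring) image_ideal_prod: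
  assumes I: "ideal I R" and J: "ideal J R"
  shows "h ` (ideal_prod R I J) = ideal_prod S (h ` I) (h ` J)"
proof
  show "h ` (ideal_prod R I J) \<subseteq> ideal_prod S (h ` I) (h ` J)"
  proof
    fix y assume "y \<in> h ` (ideal_prod R I J)"
    then obtain x where x: "x \<in> ideal_prod R I J" "y = h x"
      by auto
    have "h x \<in> ideal_prod S (h ` I) (h ` J)"
      using x(1)
    proof induction
      case (prod i j)
      then show ?case
        using ideal.Icarr[OF I] ideal.Icarr[OF J] by (simp add: ideal_prod.prod)
    next
      case (sum s t)
      then show ?case
        using R.ideal_prod_in_carrier[OF I J] by (simp add: ideal_prod.sum subset_iff)
    qed
    then show "y \<in> ideal_prod S (h ` I) (h ` J)"
      using x by simp
  qed
  show "ideal_prod S (h ` I) (h ` J) \<subseteq> h ` (ideal_prod R I J)"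
  proof
    fix y assume "y \<in> ideal_prod S (h ` I) (h ` J)"
    then show "y \<in> h ` (ideal_prod R I J)"
    proof induction
      case (prod i j)
      then obtain a b where "a \<in> I" "b \<in> J" "i = h a" "j = h b"
        by auto
      then have "i \<otimes>\<^bsub>S\<^esub> j = h (a \<otimes> b)" "a \<otimes> b \<in> ideal_prod R I J"
        using ideal.Icarr[OF I] ideal.Icarr[OF J] by (simp_all add: ideal_prod.prod)
      then show ?case by blast
    next
      case (sum s t)
      then obtain a b where ab: "a \<in> ideal_prod R I J" "b \<in> ideal_prod R I J" "s = h a" "t = h b"
        by auto
      then have "s \<oplus>\<^bsub>S\<^esub> t = h (a \<oplus> b)"
        using R.ideal_prod_in_carrier[OF I J] by (simp add: subset_iff)
      then show ?case
        using ideal_prod.sum[OF ab(1,2)] by blast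
    qed
  qed
qed

lemma (in ring_hom_ring) image_finprod_ideals:
  assumes "cring R" "cring S" and surj: "h ` carrier R = carrier S"
    and "I \<in> A \<rightarrow> ideals R"
  shows "h ` (\<Otimes>\<^bsub>ideals_set R\<^esub>i\<in>A. I i) = (\<Otimes>\<^bsub>ideals_set S\<^esub>i\<in>A. h ` I i)"
proof (rule hom_finprod)
  show "comm_monoid (ideals_set R)" "comm_monoid (ideals_set S)"
    by (simp_all add: assms cring.ideals_set_is_comm_monoid)
  show "(`) h \<in> hom (ideals_set R) (ideals_set S)"
    by (auto simp: hom_def ideals_set_def surj_image_ideal[OF surj] image_ideal_prod)
\<comment> \<open>The unit of \<open>ideals_set\<close> is the whole ring, so preservation of the
  unit is exactly \<open>surj\<close>.\<close>
qed (use assms in \<open>auto simp: ideals_set_def\<close>)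

section \<open>Ideals and zero products in a product of two rings\<close>

text \<open>The product of two rings is described by its projections, so that \<open>T\<close> need
  not consist of pairs. This fits products encoded as lists, where the projections are
  \<open>hd\<close> and \<open>tl\<close>.\<close>

locale ring_decomposition =
  T: cring T + R: cring R + S: cring S
  for T (structure) and R (structure) and S (structure) +
  fixes f g
  assumes f_hom: "f \<in> ring_hom T R" and g_hom: "g \<in> ring_hom T S"
    and bij: "bij_betw (\<lambda>x. (f x, g x)) (carrier T) (carrier R \<times> carrier S)"
begin

sublocale f: ring_hom_ring T R f
  by (unfold_locales) (rule f_hom)

sublocale g: ring_hom_ring T S g
  by (unfold_locales) (rule g_hom)

lemma lift:
  assumes "a \<in> carrier R" "b \<in> carrier S"
  obtains x where "x \<in> carrier T" "f x = a" "g x = b"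
proof -
  have "(a, b) \<in> (\<lambda>x. (f x, g x)) ` carrier T"
    using bij assms by (simp add: bij_betw_def)
  then show thesis
    using that by auto
qed

lemma components_eqD:
  assumes "x \<in> carrier T" "y \<in> carrier T" "f x = f y" "g x = g y"
  shows "x = y"
  using inj_onD[OF bij_betw_imp_inj_on[OF bij]] assms by simp

lemma f_surj: "f ` carrier T = carrier R"
proof (intro subset_antisym subsetI)
  fix a assume "a \<in> carrier R"
  then obtain x where "x \<in> carrier T" "f x = a"
    using lift[OF _ S.zero_closed] by metis
  then show "a \<in> f ` carrier T"
    by auto
qed auto

lemma g_surj: "g ` carrier T = carrier S"
proof (intro subset_antisym subsetI)
  fix b assume "b \<in> carrier S"
  then obtain x where "x \<in> carrier T" "g x = b"
    using lift[OF R.zero_closed] by metis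
  then show "b \<in> g ` carrier T"
    by auto
qed auto

text \<open>If \<open>f x = f a\<close> and \<open>g x = g b\<close> with \<open>a, b \<in> K\<close>, then \<open>x = ea + e'b\<close> for the idempotents
  \<open>e = (1, 0)\<close> and \<open>e' = (0, 1)\<close>.\<close>

lemma ideal_eq_vimage:
  assumes K: "ideal K T"
  shows "K = {x \<in> carrier T. f x \<in> f ` K \<and> g x \<in> g ` K}"
proof (intro subset_antisym subsetI)
  fix x assume "x \<in> {x \<in> carrier T. f x \<in> f ` K \<and> g x \<in> g ` K}"
  then obtain a b where x: "x \<in> carrier T" and a: "a \<in> K" "f x = f a" and b: "b \<in> K" "g x = g b"
    by auto
  obtain e where e: "e \<in> carrier T" "f e = \<one>\<^bsub>R\<^esub>" "g e = \<zero>\<^bsub>S\<^esub>"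
    using lift[OF R.one_closed S.zero_closed] .
  obtain e' where e': "e' \<in> carrier T" "f e' = \<zero>\<^bsub>R\<^esub>" "g e' = \<one>\<^bsub>S\<^esub>"
    using lift[OF R.zero_closed S.one_closed] .
  have ab: "a \<in> carrier T" "b \<in> carrier T"
    using a b ideal.Icarr[OF K] by auto
  have "x = e \<otimes> a \<oplus> e' \<otimes> b"
    by (rule components_eqD) (use x a b e e' ab in auto)
  moreover have "e \<otimes> a \<oplus> e' \<otimes> b \<in> K"
    using K a b e e'
    by (simp add: ideal.I_l_closed additive_subgroup.a_closed ideal.axioms(1))
  ultimately show "x \<in> K" by simp
qed (use ideal.Icarr[OF K] in auto)

text \<open>This provides the inverse of the map sending \<open>K\<close> to its two images. That
  the images are all of \<open>I\<close> and \<open>J\<close> is seen by lifting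
  \<open>(a, 0)\<close> and \<open>(0, b)\<close>, since every ideal contains zero.\<close>

lemma ideal_vimage:
  assumes I: "ideal I R" and J: "ideal J S"
  shows "ideal {x \<in> carrier T. f x \<in> I \<and> g x \<in> J} T"
    and "f ` {x \<in> carrier T. f x \<in> I \<and> g x \<in> J} = I"
    and "g ` {x \<in> carrier T. f x \<in> I \<and> g x \<in> J} = J"
proof -
  have "ideal ({x \<in> carrier T. f x \<in> I} \<inter> {x \<in> carrier T. g x \<in> J}) T"
    by (intro T.i_intersect f.ideal_vimage g.ideal_vimage I J)
  also have "{x \<in> carrier T. f x \<in> I} \<inter> {x \<in> carrier T. g x \<in> J}
      = {x \<in> carrier T. f x \<in> I \<and> g x \<in> J}"
    by auto
  finally show "ideal {x \<in> carrier T. f x \<in> I \<and> g x \<in> J} T" .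
  have zero: "\<zero>\<^bsub>R\<^esub> \<in> I" "\<zero>\<^bsub>S\<^esub> \<in> J"
    using I J by (simp_all add: additive_subgroup.zero_closed ideal.axioms(1))
  show "f ` {x \<in> carrier T. f x \<in> I \<and> g x \<in> J} = I"
  proof (intro subset_antisym subsetI)
    fix a assume a: "a \<in> I"
    obtain x where "x \<in> carrier T" "f x = a" "g x = \<zero>\<^bsub>S\<^esub>"
      using lift[OF ideal.Icarr[OF I a] S.zero_closed] .
    then show "a \<in> f ` {x \<in> carrier T. f x \<in> I \<and> g x \<in> J}"
      using a zero by auto
  qed auto
  show "g ` {x \<in> carrier T. f x \<in> I \<and> g x \<in> J} = J"
  proof (intro subset_antisym subsetI)
    fix b assume b: "b \<in> J"
    obtain x where "x \<in> carrier T" "f x = \<zero>\<^bsub>R\<^esub>" "g x = b"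
      using lift[OF R.zero_closed ideal.Icarr[OF J b]] .
    then show "b \<in> g ` {x \<in> carrier T. f x \<in> I \<and> g x \<in> J}"
      using b zero by auto
  qed auto
qed

text \<open>The description in \<open>ideal_eq_vimage\<close> depends on the ideal only through its
  two images.\<close>

lemma ideals_eqI:
  assumes "ideal K T" "ideal L T" "f ` K = f ` L" "g ` K = g ` L"
  shows "K = L"
  using ideal_eq_vimage[OF assms(1)] ideal_eq_vimage[OF assms(2)] assms(3,4) by simp

lemma bij_betw_ideals: "bij_betw (\<lambda>K. (f ` K, g ` K)) (ideals T) (ideals R \<times> ideals S)"
proof (rule bij_betw_imageI)
  show "inj_on (\<lambda>K. (f ` K, g ` K)) (ideals T)"
    by (rule inj_onI) (use ideals_eqI in blast)
  have "p \<in> (\<lambda>K. (f ` K, g ` K)) ` ideals T" if IJ: "p \<in> ideals R \<times> ideals S" for p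
  proof -
    obtain I J where p: "p = (I, J)" "ideal I R" "ideal J S"
      using IJ by auto
    then show ?thesis
      using ideal_vimage[OF p(2,3)]
      by (intro image_eqI[where x = "{x \<in> carrier T. f x \<in> I \<and> g x \<in> J}"]) auto
  qed
  then show "(\<lambda>K. (f ` K, g ` K)) ` ideals T = ideals R \<times> ideals S"
    using f.surj_image_ideal[OF f_surj] g.surj_image_ideal[OF g_surj] by auto
qed

text \<open>Taking images commutes with products of ideals, and by \<open>ideals_eqI\<close> the
  zero ideal is the only ideal whose two images are both zero.\<close>

lemma finprod_ideals_eq_zero_iff:
  assumes "K \<in> A \<rightarrow> ideals T"
  shows "(\<Otimes>\<^bsub>ideals_set T\<^esub>i\<in>A. K i) = {\<zero>} \<longleftrightarrow>
    (\<Otimes>\<^bsub>ideals_set R\<^esub>i\<in>A. f ` K i) = {\<zero>\<^bsub>R\<^esub>} \<and> (\<Otimes>\<^bsub>ideals_set S\<^esub>i\<in>A. g ` K i) = {\<zero>\<^bsub>S\<^esub>}"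
proof -
  let ?P = "\<Otimes>\<^bsub>ideals_set T\<^esub>i\<in>A. K i"
  have "?P \<in> carrier (ideals_set T)"
    by (rule comm_monoid.finprod_closed[OF T.ideals_set_is_comm_monoid])
      (use assms in \<open>simp add: ideals_set_def\<close>)
  then have P: "ideal ?P T"
    by (simp add: ideals_set_def)
  have "?P = {\<zero>} \<longleftrightarrow> f ` ?P = f ` {\<zero>} \<and> g ` ?P = g ` {\<zero>}"
    using ideals_eqI[OF P T.zeroideal] by auto
  then show ?thesis
    using f.image_finprod_ideals[OF T.is_cring R.is_cring f_surj assms]
      g.image_finprod_ideals[OF T.is_cring S.is_cring g_surj assms]
    by simp
qed

text \<open>Applying the bijection on ideals in each coordinate matches zero-product tuples of
  \<open>T\<close> with pairs of such tuples, which factors the numerator;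
  \<open>bij_betw_ideals\<close> itself factors the denominator.\<close>

lemma zeta_eq_mult: "zeta k T = zeta k R * zeta k S"
proof -
  let ?N = "{1..k}"
  define ZT where
    "ZT = {K \<in> ?N \<rightarrow>\<^sub>E ideals T. (\<Otimes>\<^bsub>ideals_set T\<^esub>i\<in>?N. K i) = {\<zero>}}"
  define ZR where
    "ZR = {I \<in> ?N \<rightarrow>\<^sub>E ideals R. (\<Otimes>\<^bsub>ideals_set R\<^esub>i\<in>?N. I i) = {\<zero>\<^bsub>R\<^esub>}}"
  define ZS where
    "ZS = {J \<in> ?N \<rightarrow>\<^sub>E ideals S. (\<Otimes>\<^bsub>ideals_set S\<^esub>i\<in>?N. J i) = {\<zero>\<^bsub>S\<^esub>}}"
  \<comment> \<open>Both components are restricted to \<open>?N\<close> because the tuples counted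
    by \<open>zeta\<close> are extensional.\<close>
  define F where "F = (\<lambda>K. (\<lambda>i\<in>?N. f ` K i, \<lambda>i\<in>?N. g ` K i))"
  have finprod_restrict:
    "(\<Otimes>\<^bsub>ideals_set R\<^esub>i\<in>?N. (\<lambda>i\<in>?N. f ` K i) i) = (\<Otimes>\<^bsub>ideals_set R\<^esub>i\<in>?N. f ` K i)"
    "(\<Otimes>\<^bsub>ideals_set S\<^esub>i\<in>?N. (\<lambda>i\<in>?N. g ` K i) i) = (\<Otimes>\<^bsub>ideals_set S\<^esub>i\<in>?N. g ` K i)"
    if "K \<in> ?N \<rightarrow> ideals T" for K
    by (rule comm_monoid.finprod_cong'[OF R.ideals_set_is_comm_monoid]
        comm_monoid.finprod_cong'[OF S.ideals_set_is_comm_monoid];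
      use that f.surj_image_ideal[OF f_surj] g.surj_image_ideal[OF g_surj]
        in \<open>auto simp: ideals_set_def\<close>)+
  have F_mem: "F K \<in> ZR \<times> ZS \<longleftrightarrow> K \<in> ZT" if "K \<in> ?N \<rightarrow>\<^sub>E ideals T" for K
  proof -
    have K: "K \<in> ?N \<rightarrow> ideals T"
      using that by auto
    then have "(\<lambda>i\<in>?N. f ` K i) \<in> ?N \<rightarrow>\<^sub>E ideals R" "(\<lambda>i\<in>?N. g ` K i) \<in> ?N \<rightarrow>\<^sub>E ideals S"
      using f.surj_image_ideal[OF f_surj] g.surj_image_ideal[OF g_surj] by auto
    then show ?thesis
      using that
      unfolding F_def ZT_def ZR_def ZS_def mem_Times_iff fst_conv snd_conv mem_Collect_eq
        finprod_restrict[OF K] finprod_ideals_eq_zero_iff[OF K] by blast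
  qed
  have "bij_betw F ZT (ZR \<times> ZS)"
    unfolding bij_betw_def
  proof (intro conjI inj_onI subset_antisym subsetI)
    fix K L assume KL: "K \<in> ZT" "L \<in> ZT" "F K = F L"
    show "K = L"
    proof (rule PiE_ext)
      show "K \<in> ?N \<rightarrow>\<^sub>E ideals T" "L \<in> ?N \<rightarrow>\<^sub>E ideals T"
        using KL by (auto simp: ZT_def)
      fix i assume i: "i \<in> ?N"
      have "fst (F K) i = fst (F L) i" "snd (F K) i = snd (F L) i"
        by (simp_all only: KL(3))
      then have "f ` K i = f ` L i" "g ` K i = g ` L i"
        using i by (simp_all add: F_def)
      then show "K i = L i"
        using KL i by (intro ideals_eqI) (auto simp: ZT_def PiE_iff)
    qed
  next
    fix p assume p: "p \<in> ZR \<times> ZS"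
    obtain I J where IJ: "p = (I, J)"
      by fastforce
    \<comment> \<open>The preimage of \<open>p\<close> is built in each coordinate from the inverse
      given by \<open>ideal_vimage\<close>.\<close>
    define K where "K = (\<lambda>i\<in>?N. {x \<in> carrier T. f x \<in> I i \<and> g x \<in> J i})"
    have I: "I \<in> ?N \<rightarrow>\<^sub>E ideals R" and J: "J \<in> ?N \<rightarrow>\<^sub>E ideals S"
      using p IJ by (auto simp: ZR_def ZS_def)
    then have id: "ideal (I i) R" "ideal (J i) S" if "i \<in> ?N" for i
      using that by auto
    have K: "K \<in> ?N \<rightarrow>\<^sub>E ideals T"
      using ideal_vimage(1)[OF id] by (auto simp: K_def)
    have "(\<lambda>i\<in>?N. f ` K i) = I"
      by (rule PiE_ext[OF _ I])
        (use ideal_vimage(2)[OF id] id in \<open>auto simp: K_def\<close>)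
    moreover have "(\<lambda>i\<in>?N. g ` K i) = J"
      by (rule PiE_ext[OF _ J])
        (use ideal_vimage(3)[OF id] id in \<open>auto simp: K_def\<close>)
    ultimately have "p = F K"
      by (simp add: F_def IJ)
    then show "p \<in> F ` ZT"
      using F_mem[OF K] p by simp
  next
    fix p assume "p \<in> F ` ZT"
    then obtain K where K: "K \<in> ZT" "p = F K"
      by (rule imageE)
    then have "K \<in> ?N \<rightarrow>\<^sub>E ideals T"
      by (simp add: ZT_def)
    then show "p \<in> ZR \<times> ZS"
      using F_mem K by simp
  qed
  then have "card ZT = card ZR * card ZS"
    by (simp add: bij_betw_same_card card_cartesian_product)
  moreover have "card (ideals T) = card (ideals R) * card (ideals S)"
    using bij_betw_same_card[OF bij_betw_ideals] by (simp add: card_cartesian_product)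
  ultimately show ?thesis
    by (simp add: zeta_def ZT_def ZR_def ZS_def power_mult_distrib)
qed

end

section \<open>Finite products of rings encoded as lists\<close>

text \<open>Prepending an entry is a ring homomorphism from
  \<open>RDirProd R (RDirProd_list Rs)\<close>, so the operations can be read off from those on
  pairs.\<close>

lemma RDirProd_list_Cons_simps:
  assumes "a \<in> carrier R" "b \<in> carrier R"
    and "as \<in> carrier (RDirProd_list Rs)" "bs \<in> carrier (RDirProd_list Rs)"
  shows "(a # as) \<otimes>\<^bsub>RDirProd_list (R # Rs)\<^esub> (b # bs)
      = (a \<otimes>\<^bsub>R\<^esub> b) # (as \<otimes>\<^bsub>RDirProd_list Rs\<^esub> bs)"
    and "(a # as) \<oplus>\<^bsub>RDirProd_list (R # Rs)\<^esub> (b # bs)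
      = (a \<oplus>\<^bsub>R\<^esub> b) # (as \<oplus>\<^bsub>RDirProd_list Rs\<^esub> bs)"
  using ring_hom_mult[OF RDirProd_list_hom1, of "(a, as)" R Rs "(b, bs)"]
    ring_hom_add[OF RDirProd_list_hom1, of "(a, as)" R Rs "(b, bs)"] assms
  by (simp_all add: RDirProd_carrier) (simp_all add: RDirProd_def DirProd_def monoid.defs)

lemma RDirProd_list_Cons_one:
  "\<one>\<^bsub>RDirProd_list (R # Rs)\<^esub> = \<one>\<^bsub>R\<^esub> # \<one>\<^bsub>RDirProd_list Rs\<^esub>"
  by (simp add: RDirProd_list_one)

lemma RDirProd_list_cring:
  assumes "\<And>R. R \<in> set Rs \<Longrightarrow> cring R"
  shows "cring (RDirProd_list Rs)"
proof -
  have ring: "ring (RDirProd_list Rs)"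
    using assms by (intro RDirProd_list_is_ring) (simp add: cring.axioms(1))
  \<comment> \<open>Only commutativity remains; it is checked entry by entry, by induction on the
    list of rings.\<close>
  have "x \<otimes>\<^bsub>RDirProd_list Rs\<^esub> y = y \<otimes>\<^bsub>RDirProd_list Rs\<^esub> x"
    if "x \<in> carrier (RDirProd_list Rs)" "y \<in> carrier (RDirProd_list Rs)" for x y
    using assms that
  proof (induction Rs arbitrary: x y)
    case Nil
    then show ?case
      by (simp add: monoid.defs)
  next
    case (Cons R Rs)
    then have "comm_monoid R"
      by (simp add: cring.axioms(2))
    with Cons show ?case
      by (auto simp: RDirProd_list_carrier RDirProd_list_Cons_simps
          intro: comm_monoid.m_comm)
  qed
  then show ?thesis
    using ring by (intro cring.intro comm_monoid.intro comm_monoid_axioms.intro)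
      (auto simp: ring.axioms)
qed

text \<open>Splitting a list into head and tail makes a nonempty product an instance of the binary
  case.\<close>

lemma RDirProd_list_Cons_decomposition:
  assumes "cring R" "\<And>R. R \<in> set Rs \<Longrightarrow> cring R"
  shows "ring_decomposition (RDirProd_list (R # Rs)) R (RDirProd_list Rs) hd tl"
proof (intro ring_decomposition.intro ring_decomposition_axioms.intro)
  show "cring R" "cring (RDirProd_list Rs)" "cring (RDirProd_list (R # Rs))"
    using assms by (auto intro!: RDirProd_list_cring)
  show "hd \<in> ring_hom (RDirProd_list (R # Rs)) R"
    "tl \<in> ring_hom (RDirProd_list (R # Rs)) (RDirProd_list Rs)"
    by (auto intro!: ring_hom_memI
        simp: RDirProd_list_carrier RDirProd_list_Cons_simps RDirProd_list_Cons_one)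
  show "bij_betw (\<lambda>x. (hd x, tl x)) (carrier (RDirProd_list (R # Rs)))
      (carrier R \<times> carrier (RDirProd_list Rs))"
    by (auto simp: bij_betw_def RDirProd_list_carrier inj_on_def image_iff)
qed

lemma nil_ring_zero: "\<zero>\<^bsub>nil_ring\<^esub> = []"
  by (simp add: monoid.defs)

text \<open>This is the base case, the empty product. The zero ring has a single ideal, so every
  product of ideals is zero and the quotient is \<open>1 / 1\<close>.\<close>

lemma zeta_nil_ring: "zeta k (nil_ring :: 'c list ring) = 1"
proof -
  let ?N = "nil_ring :: 'c list ring"
  have cring: "cring ?N"
    using RDirProd_list_cring[of "[]"] by simp
  then interpret cring ?N .
  interpret M: comm_monoid "ideals_set ?N"
    by (rule ideals_set_is_comm_monoid)
  have *: "ideals ?N = {{[]}}"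
  proof (intro subset_antisym subsetI)
    fix I assume "I \<in> ideals ?N"
    then have "ideal I ?N" by simp
    then have "I \<subseteq> {[]}" "[] \<in> I"
      using ideal.Icarr[of I "?N"] additive_subgroup.zero_closed[OF ideal.axioms(1), of I "?N"]
      by (auto simp: nil_ring_zero)
    then show "I \<in> {{[]}}" by auto
  qed (use zeroideal in \<open>simp add: nil_ring_zero\<close>)
  have "(\<Otimes>\<^bsub>ideals_set ?N\<^esub>i\<in>{1..k}. I i) = {[]}"
    if "I \<in> {1..k} \<rightarrow>\<^sub>E ideals ?N" for I
  proof -
    have "(\<Otimes>\<^bsub>ideals_set ?N\<^esub>i\<in>{1..k}. I i) \<in> ideals ?N"
      using M.finprod_closed[of I "{1..k}"] that by (auto simp: ideals_set_def)
    then show ?thesis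
      unfolding * by simp
  qed
  then have "{I \<in> {1..k} \<rightarrow>\<^sub>E ideals ?N.
      (\<Otimes>\<^bsub>ideals_set ?N\<^esub>i\<in>{1..k}. I i) = {\<zero>\<^bsub>?N\<^esub>}}
    = {1..k} \<rightarrow>\<^sub>E ideals ?N"
    by (auto simp: nil_ring_zero)
  then show ?thesis
    unfolding zeta_def * by (simp add: card_PiE)
qed

text \<open>Induction on the list: each step splits off the first ring and applies the binary
  product formula.\<close>

lemma zeta_RDirProd_list:
  assumes "\<And>R. R \<in> set Rs \<Longrightarrow> cring R"
  shows "zeta k (RDirProd_list Rs) = prod_list (map (zeta k) Rs)"
  using assms
proof (induction Rs)
  case Nil
  then show ?case
    by (simp add: zeta_nil_ring)
next
  case (Cons R Rs)
  then show ?case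
    using ring_decomposition.zeta_eq_mult[OF RDirProd_list_Cons_decomposition, of R Rs k] by simp
qed

theorem corollary3p2:
  fixes R :: "nat \<Rightarrow> ('a, 'b) ring_scheme" and m k :: nat
  assumes "\<And>i. i \<in> {1..m} \<Longrightarrow> cring (R i)"
    and "\<And>i. i \<in> {1..m} \<Longrightarrow> finite (carrier (R i))"
    and "2 \<le> k"
  shows "zeta k (RDirProd_list (map R [1..<Suc m])) = (\<Prod>i = 1..m. zeta k (R i))"
proof -
  have "zeta k (RDirProd_list (map R [1..<Suc m])) = prod_list (map (zeta k) (map R [1..<Suc m]))"
    by (rule zeta_RDirProd_list) (use assms(1) in auto)
  \<comment> \<open>The entries of \<open>[1..<Suc m]\<close> are distinct, so the product over the
    list equals the product over its set. Removing \<open>upt_Suc\<close> from the simplifier keeps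
    the interval from being unfolded at its upper end.\<close>
  also have "\<dots> = (\<Prod>i\<in>set [1..<Suc m]. zeta k (R i))"
    by (subst prod.distinct_set_conv_list) (simp_all add: comp_def del: upt_Suc)
  also have "set [1..<Suc m] = {1..m}"
    by auto
  finally show ?thesis .
qed

end
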